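(* Let $k\ge2$ be a fixed integer and $\delta>0$. Then for all sufficiently large $x$ and all $T$ with $2\le T\le e^{(\log x)^{1-\delta}}$, $$\Psi_k(x,T):=\#\{n\le x:\ P_k(n)\le T\}\ll_{k,\delta}\frac{x(\log\log x)^{k-2}\log T}{\log x}.$$ In particular, for each fixed $k$, $P_k(n)\to\infty$ for almost all $n$, i.e. for every fixed $T$ the set of $n$ with $P_k(n)\le T$ has natural density $0$.
   Context: For a positive integer $n$ with distinct prime factors $q_1>q_2>\cdots>q_r$, $P_k(n):=q_k$ if $r\ge k$ and $P_k(n):=1$ if $r<k$. $\ll_{k,\delta}$ means the implied constant depends only on $k$ and $\delta$. *)

theory Defs
  imports Complex_Main "HOL-Computational_Algebra.Primes"
begin

text \<open>The \<open>k\<close>-th largest distinct prime factor of \<open>n\<close>, for \<open>k \<ge> 1\<close> and \<open>n \<ge> 1\<close>;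
  it is 1 if \<open>n\<close> has fewer than \<open>k\<close> distinct prime factors. The list is decreasing and
  free of repetitions, and list positions start at 0.\<close>

definition P :: "nat \<Rightarrow> nat \<Rightarrow> nat" where
  "P k n = (let qs = rev (sorted_list_of_set (prime_factors n))
            in if k \<le> length qs then qs ! (k - 1) else 1)"

definition Psi :: "nat \<Rightarrow> real \<Rightarrow> real \<Rightarrow> nat" where
  "Psi k x T = card {n :: nat. 1 \<le> n \<and> real n \<le> x \<and> real (P k n) \<le> T}"

definition has_natural_density :: "nat set \<Rightarrow> real \<Rightarrow> bool" where
  "has_natural_density A d \<longleftrightarrow>
     (\<lambda>N. real (card (A \<inter> {1..N})) / real N) \<longlonglongrightarrow> d"

end

theory Submission
  imports Defs "HOL-Real_Asymp.Real_Asymp"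
begin

text \<open>If \<open>P k n \<le> T\<close>, then \<open>n\<close> has at most \<open>k - 1\<close> distinct prime factors above \<open>T\<close>. By Rankin's
  trick, few \<open>n \<le> x\<close> have a \<open>T\<close>-smooth part above \<open>sqrt x\<close>. Every other \<open>n > x powr (3/4)\<close> has a
  \<open>T\<close>-rough part whose logarithm is at least \<open>ln x / 4\<close>. This logarithm is the sum of
  \<open>ln (p ^ j)\<close> over the prime powers \<open>p ^ j\<close> exactly dividing \<open>n\<close> with \<open>p > T\<close>; writing
  \<open>n = c * p ^ j\<close>, where \<open>c\<close> has at most \<open>k - 2\<close> primes above \<open>T\<close>, and summing over \<open>p ^ j \<le> x / c\<close>
  with Chebyshev's bound, the total over all \<open>n\<close> is \<open>O(x \<Sum> 1 / c)\<close>. Mertens' upper bound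
  \<open>\<Sum>p\<le>y. 1 / p \<le> ln (ln y) + O(1)\<close>, used at \<open>y = T\<close> for the smooth part of \<open>c\<close> and at \<open>y = x\<close> for
  its large prime powers, gives \<open>\<Sum> 1 / c = O(ln T (ln (ln x)) ^ (k - 2))\<close>.\<close>

section \<open>Upper bounds of Chebyshev and Mertens\<close>

definition primes_le :: "real \<Rightarrow> nat set" where
  "primes_le x = {p. prime p \<and> real p \<le> x}"

lemma finite_nat_le [simp]: "finite {n :: nat. real n \<le> x}"
  by (rule finite_subset[of _ "{..nat \<lfloor>x\<rfloor>}"]) (auto simp: le_nat_floor)

lemma finite_primes_le [simp]: "finite (primes_le x)"
  by (rule finite_subset[OF _ finite_nat_le[of x]]) (auto simp: primes_le_def)

lemma primes_le_floor:
  assumes "x \<ge> 0"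
  shows "primes_le x = primes_le (real (nat \<lfloor>x\<rfloor>))"
proof -
  have "real p \<le> x \<longleftrightarrow> real p \<le> real (nat \<lfloor>x\<rfloor>)" for p
    by (metis assms le_nat_floor of_nat_floor of_nat_le_iff order_trans)
  then show ?thesis by (simp add: primes_le_def)
qed

lemma primes_le_Suc:
  "primes_le (real (Suc n)) = (if prime (Suc n) then insert (Suc n) (primes_le (real n)) else primes_le (real n))"
  by (auto simp: primes_le_def le_Suc_eq simp del: of_nat_Suc)

lemma prod_primes_dvd:
  fixes m :: nat
  assumes "finite A" "\<And>p. p \<in> A \<Longrightarrow> prime p" "\<And>p. p \<in> A \<Longrightarrow> p dvd m"
  shows "\<Prod>A dvd m"
  using assms
proof (induction A)
  case (insert p A)
  have "coprime p (\<Prod>A)"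
    using insert.prems insert.hyps by (intro prod_coprime_right) (metis insertCI primes_coprime)
  with insert show ?case by (auto intro: divides_mult)
qed auto

text \<open>Distinct primes dividing \<open>m\<close> multiply to a divisor of \<open>m\<close>;
  take logarithms. Applied to central binomial coefficients for Chebyshev's bound and to every
  integer up to \<open>n\<close> for Mertens'.\<close>

lemma sum_ln_primes_dvd_le:
  fixes m :: nat
  assumes "m > 0" "finite A" "\<And>p. p \<in> A \<Longrightarrow> prime p" "\<And>p. p \<in> A \<Longrightarrow> p dvd m"
  shows "(\<Sum>p\<in>A. ln (real p)) \<le> ln (real m)"
proof -
  have pos: "p > 0" if "p \<in> A" for p using assms(3)[OF that] by (simp add: prime_gt_0_nat)
  have "(\<Sum>p\<in>A. ln (real p)) = ln (real (\<Prod>A))"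
    using pos assms(2) by (simp add: ln_prod of_nat_prod)
  also have "\<Prod>A \<le> m"
    using prod_primes_dvd[OF assms(2-4)] assms(1) by (rule dvd_imp_le)
  then have "ln (real (\<Prod>A)) \<le> ln (real m)"
    using pos by (subst ln_le_cancel_iff) (auto simp: prod_pos assms(1) simp del: of_nat_prod)
  finally show ?thesis .
qed

section \<open>Chebyshev's linear upper bound\<close>

definition theta :: "real \<Rightarrow> real" where
  "theta x = (\<Sum>p\<in>primes_le x. ln (real p))"

text \<open>Every prime in \<open>(n, 2 * n]\<close> divides the central binomial coefficient, which
  is at most \<open>2 ^ (2 * n)\<close>.\<close>

lemma theta_double: "theta (real (2 * n)) \<le> theta (real n) + 2 * real n * ln 2"
proof -
  let ?A = "primes_le (real (2 * n)) - primes_le (real n)"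
  have dvd: "p dvd (2 * n choose n)" if "p \<in> ?A" for p
  proof -
    have p: "prime p" "n < p" "p \<le> 2 * n" using that by (auto simp: primes_le_def)
    have "p dvd fact (2 * n)" using p by (simp add: prime_dvd_fact_iff)
    also have "fact (2 * n) = fact n * fact n * (2 * n choose n)"
      using binomial_fact_lemma[of n "2 * n"] by (simp add: mult_2)
    finally show ?thesis using p by (simp add: prime_dvd_mult_iff prime_dvd_fact_iff)
  qed
  have "(\<Sum>p\<in>?A. ln (real p)) \<le> ln (real (2 * n choose n))"
    by (rule sum_ln_primes_dvd_le) (auto simp: primes_le_def dvd)
  also have "\<dots> \<le> ln (2 ^ (2 * n))"
    by (subst ln_le_cancel_iff) (use binomial_le_pow2[of "2*n" n] of_nat_le_iff[of "2 * n choose n" "2 ^ (2 * n)"] in auto)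
  also have "\<dots> = 2 * real n * ln 2" by (simp add: ln_realpow)
  finally have "(\<Sum>p\<in>?A. ln (real p)) \<le> 2 * real n * ln 2" .
  moreover have "theta (real (2 * n)) = theta (real n) + (\<Sum>p\<in>?A. ln (real p))"
    unfolding theta_def by (subst sum.subset_diff[of "primes_le (real n)"]) (auto simp: primes_le_def)
  ultimately show ?thesis by simp
qed

text \<open>Induction by halving: for \<open>m = n div 2\<close> the doubling bound raises
  \<open>4 * m\<close> to \<open>6 * m\<close>, and the remaining room below \<open>4 * n\<close>
  absorbs the possible extra prime \<open>n\<close> in the odd case, since
  \<open>ln n \<le> n * ln 2\<close>.\<close>

lemma theta_nat_le: "theta (real n) \<le> 4 * real n * ln 2"
proof (induction n rule: less_induct)
  case (less n)
  show ?case
  proof (cases "n = 0")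
    case True
    then show ?thesis by (simp add: theta_def primes_le_def)
  next
    case False
    define m where "m = n div 2"
    have IH: "theta (real m) \<le> 4 * real m * ln 2" using less False by (auto simp: m_def)
    have even: "theta (real (2 * m)) \<le> 6 * real m * ln 2" using theta_double[of m] IH by simp
    show ?thesis
    proof (cases "even n")
      case True
      then have "n = 2 * m" by (auto simp: m_def)
      with even show ?thesis by (simp add: mult_right_mono order_trans)
    next
      case False
      then have n: "n = Suc (2 * m)" by (auto simp: m_def)
      have "theta (real n) \<le> theta (real (2 * m)) + ln (real n)"
        unfolding theta_def n primes_le_Suc
        by (auto simp: sum.insert_if primes_le_def ln_ge_zero simp del: of_nat_Suc)
      also have "ln (real n) \<le> ln (2 ^ n)"
        using n by (subst ln_le_cancel_iff) (auto simp: less_imp_le simp del: of_nat_Suc power_Suc)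
      also have "\<dots> = real n * ln 2" by (simp add: ln_realpow)
      finally have "theta (real n) \<le> (6 * real m + real n) * ln 2" using even by (simp add: algebra_simps)
      also have "\<dots> \<le> (4 * real n) * ln 2" by (intro mult_right_mono) (auto simp: n)
      finally show ?thesis by simp
    qed
  qed
qed

lemma theta_le:
  assumes "x \<ge> 0"
  shows "theta x \<le> 4 * x"
proof -
  have "theta x = theta (real (nat \<lfloor>x\<rfloor>))"
    unfolding theta_def using primes_le_floor[OF assms] by simp
  also have "\<dots> \<le> 4 * real (nat \<lfloor>x\<rfloor>) * ln 2" by (rule theta_nat_le)
  also have "\<dots> \<le> 4 * real (nat \<lfloor>x\<rfloor>) * 1" using ln_2_less_1 by (intro mult_left_mono) auto
  also have "\<dots> \<le> 4 * x" using assms by simp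
  finally show ?thesis .
qed

section \<open>Mertens' upper bounds\<close>

text \<open>Count the pairs of a prime \<open>p\<close> and a multiple \<open>m \<le> n\<close> of
  it with weight \<open>ln p\<close>. Each \<open>p\<close> has at least \<open>n / p - 1\<close>
  multiples, and each \<open>m\<close> receives at most \<open>ln m \<le> ln n\<close>. The loss
  from the \<open>- 1\<close> is \<open>theta n \<le> 4 * n\<close>, hence the constant 4.\<close>

lemma mertens_first:
  "(\<Sum>p\<in>primes_le (real n). ln (real p) / real p) \<le> ln (real n) + 4"
proof (cases "n = 0")
  case True
  then show ?thesis by (simp add: primes_le_def)
next
  case False
  let ?P = "primes_le (real n)"
  have count: "real (card {m \<in> {1..n}. p dvd m}) \<ge> real n / real p - 1" if "p \<in> ?P" for p
  proof -
    have p: "p > 0" using that by (auto simp: primes_le_def prime_gt_0_nat)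
    have "(\<lambda>i. p * i) ` {1..n div p} \<subseteq> {m \<in> {1..n}. p dvd m}"
    proof safe
      fix i assume "i \<in> {1..n div p}"
      then have i: "1 \<le> i" "i \<le> n div p" by auto
      have "p * i \<le> p * (n div p)" using i by simp
      also have "\<dots> \<le> n" by simp
      finally show "p * i \<in> {1..n}" using i p by auto
    qed auto
    then have "card ((\<lambda>i. p * i) ` {1..n div p}) \<le> card {m \<in> {1..n}. p dvd m}"
      by (intro card_mono) auto
    moreover have "card ((\<lambda>i. p * i) ` {1..n div p}) = n div p"
      using p by (subst card_image) (auto simp: inj_on_def)
    moreover have "real n / real p - 1 \<le> real (n div p)"
      using floor_divide_of_nat_eq[of n p, where ?'a = real] by linarith
    ultimately show ?thesis by linarith
  qed
  have "real n * (\<Sum>p\<in>?P. ln (real p) / real p) - theta (real n)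
      = (\<Sum>p\<in>?P. ln (real p) * (real n / real p - 1))"
    by (simp add: theta_def sum_distrib_left sum_subtractf algebra_simps)
  also have "\<dots> \<le> (\<Sum>p\<in>?P. ln (real p) * real (card {m \<in> {1..n}. p dvd m}))"
    using count by (intro sum_mono mult_left_mono ln_ge_zero) (auto simp: primes_le_def dest: prime_ge_1_nat)
  also have "\<dots> = (\<Sum>p\<in>?P. \<Sum>m\<in>{1..n}. if p dvd m then ln (real p) else 0)"
    by (intro sum.cong refl) (simp add: sum.If_cases mult.commute Int_def)
  also have "\<dots> = (\<Sum>m\<in>{1..n}. \<Sum>p\<in>?P. if p dvd m then ln (real p) else 0)"
    by (rule sum.swap)
  also have "\<dots> \<le> (\<Sum>m\<in>{1..n}. ln (real m))"
  proof (rule sum_mono)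
    fix m assume m: "m \<in> {1..n}"
    have "(\<Sum>p\<in>?P. if p dvd m then ln (real p) else 0) = (\<Sum>p\<in>{p\<in>?P. p dvd m}. ln (real p))"
      by (subst sum.inter_filter) auto
    also have "\<dots> \<le> ln (real m)"
      using m by (intro sum_ln_primes_dvd_le) (auto simp: primes_le_def)
    finally show "(\<Sum>p\<in>?P. if p dvd m then ln (real p) else 0) \<le> ln (real m)" .
  qed
  also have "\<dots> \<le> (\<Sum>m\<in>{1..n}. ln (real n))"
    by (intro sum_mono) auto
  also have "\<dots> = real n * ln (real n)" by simp
  finally have "real n * (\<Sum>p\<in>?P. ln (real p) / real p) \<le> real n * (ln (real n) + 4)"
    using theta_le[of "real n"] by (simp add: algebra_simps)
  with False show ?thesis by simp
qed

text \<open>Abel summation as an induction on \<open>n\<close>: with \<open>A(n) = (\<Sum>p\<le>n. ln p / p)\<close>, the term \<open>A(n) / ln n\<close>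
  absorbs each new prime exactly, and its decrease between primes is controlled by
  Mertens' first bound and \<open>1 - ln n / ln (n + 1) \<le> ln (ln (n + 1)) - ln (ln n)\<close>.\<close>

lemma sum_inverse_primes_le_abel:
  assumes "n \<ge> 2"
  shows "(\<Sum>p\<in>primes_le (real n). 1 / real p)
    \<le> (\<Sum>p\<in>primes_le (real n). ln (real p) / real p) / ln (real n)
      + ln (ln (real n)) - ln (ln 2) + 4 / ln 2 - 4 / ln (real n)"
  using assms
proof (induction n rule: dec_induct)
  \<comment> \<open>The constants \<open>- ln (ln 2) + 4 / ln 2\<close> make both sides equal to 1/2
    at \<open>n = 2\<close>.\<close>
  case base
  have "{p. prime p \<and> real p \<le> 2} = {2 :: nat}"
    using prime_ge_2_nat by (auto intro: antisym)
  then show ?case by (simp add: primes_le_def)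
next
  case (step n)
  define A where "A = (\<Sum>p\<in>primes_le (real n). ln (real p) / real p)"
  define l l' where "l = ln (real n)" and "l' = ln (real (Suc n))"
  have l: "0 < l" "l \<le> l'" "0 < l'" using step by (auto simp: l_def l'_def)
  have A: "A \<le> l + 4" unfolding A_def l_def by (rule mertens_first)
  have "A * (1 / l - 1 / l') \<le> (l + 4) * (1 / l - 1 / l')"
    using A l by (intro mult_right_mono) (auto simp: field_simps)
  also have "\<dots> = (1 - l / l') + 4 * (1 / l - 1 / l')" using l by (simp add: field_simps)
  also have "1 - l / l' \<le> ln l' - ln l"
    using ln_le_minus_one[of "l / l'"] l by (simp add: ln_div)
  finally have key: "A / l \<le> A / l' + (ln l' - ln l) + 4 / l - 4 / l'" by (simp add: algebra_simps)
  have notin: "Suc n \<notin> primes_le (real n)" by (simp add: primes_le_def)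
  show ?case
  proof (cases "prime (Suc n)")
    case True
    then show ?thesis using step.IH key l notin
      by (simp add: primes_le_Suc A_def[symmetric] l_def[symmetric] l'_def[symmetric] add_divide_distrib del: of_nat_Suc)
  next
    case False
    then show ?thesis using step.IH key
      by (simp add: primes_le_Suc A_def[symmetric] l_def[symmetric] l'_def[symmetric] del: of_nat_Suc)
  qed
qed

text \<open>Since \<open>1 / (p - 1)\<close> is the sum of \<open>1 / p ^ j\<close> over
  \<open>j \<ge> 1\<close>, this bounds reciprocals of prime powers as well as logarithms of Euler
  factors.\<close>

definition pred_prime_sum :: "real \<Rightarrow> real" where
  "pred_prime_sum x = (\<Sum>p\<in>primes_le x. 1 / (real p - 1))"

lemma sum_inverse_pronic_le: "n \<ge> 1 \<Longrightarrow> (\<Sum>m\<in>{2..n}. 1 / (real m * (real m - 1))) \<le> 1 - 1 / real n"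
proof (induction n rule: dec_induct)
  case (step n)
  have "1 / (real (Suc n) * (real (Suc n) - 1)) = 1 / real n - 1 / real (Suc n)"
    using step by (simp add: field_simps)
  with step show ?case by simp
qed auto

text \<open>Split \<open>1 / (p - 1) = 1 / p + 1 / (p * (p - 1))\<close>. The second part is
  dominated by a telescoping sum and the first is Mertens' sum.\<close>

lemma pred_prime_sum_le:
  obtains c where "\<And>x. x \<ge> 2 \<Longrightarrow> pred_prime_sum x \<le> ln (ln x) + c"
proof
  fix x :: real assume x: "x \<ge> 2"
  define n where "n = nat \<lfloor>x\<rfloor>"
  have n: "n \<ge> 2" "real n \<le> x" using x by (auto simp: n_def le_nat_floor)
  have P: "primes_le x = primes_le (real n)" using primes_le_floor[of x] x by (simp add: n_def)
  have "pred_prime_sum x = (\<Sum>p\<in>primes_le (real n). 1 / real p + 1 / (real p * (real p - 1)))"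
    unfolding pred_prime_sum_def P
  proof (intro sum.cong refl)
    fix p assume "p \<in> primes_le (real n)"
    then have "p > 1" by (auto simp: primes_le_def prime_gt_Suc_0_nat)
    then show "1 / (real p - 1) = 1 / real p + 1 / (real p * (real p - 1))"
      by (simp add: field_simps)
  qed
  also have "\<dots> = (\<Sum>p\<in>primes_le (real n). 1 / real p) + (\<Sum>p\<in>primes_le (real n). 1 / (real p * (real p - 1)))"
    by (simp add: sum.distrib)
  also have "(\<Sum>p\<in>primes_le (real n). 1 / (real p * (real p - 1))) \<le> (\<Sum>m\<in>{2..n}. 1 / (real m * (real m - 1)))"
    by (intro sum_mono2) (auto simp: primes_le_def dest: prime_gt_1_nat)
  also have "\<dots> \<le> 1" using sum_inverse_pronic_le[of n] n by (simp add: order_trans)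
  \<comment> \<open>Mertens' first bound turns the quotient into \<open>1 + 4 / ln n\<close>, whose
    last term cancels the final \<open>- 4 / ln n\<close>.\<close>
  also have "(\<Sum>p\<in>primes_le (real n). 1 / real p) \<le> (ln (real n) + 4) / ln (real n)
      + ln (ln (real n)) - ln (ln 2) + 4 / ln 2 - 4 / ln (real n)"
    using sum_inverse_primes_le_abel[OF n(1)] divide_right_mono[OF mertens_first[of n], of "ln (real n)"] n
    by simp
  also have "\<dots> = 1 + ln (ln (real n)) - ln (ln 2) + 4 / ln 2" using n by (simp add: add_divide_distrib)
  also have "ln (ln (real n)) \<le> ln (ln x)" using n by simp
  finally show "pred_prime_sum x \<le> ln (ln x) + (2 - ln (ln 2) + 4 / ln 2)" by simp
qed

section \<open>Prime powers and Euler products\<close>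

text \<open>Stripping the full power of \<open>p\<close>, rather than a single factor, deletes
  \<open>p\<close> from the set of prime factors and leaves the others. The Euler product and the
  count of large primes both descend along this step.\<close>

lemma prime_power_decompose:
  fixes n p :: nat
  assumes "n > 0" "prime p"
  defines "c \<equiv> n div p ^ multiplicity p n"
  shows "n = p ^ multiplicity p n * c" "c > 0" "prime_factors c = prime_factors n - {p}"
proof -
  show n: "n = p ^ multiplicity p n * c"
    unfolding c_def by (simp add: multiplicity_dvd)
  show c: "c > 0" using n assms(1) by (metis gr0I mult_0_right)
  have "\<not> is_unit p" using assms(2) by (rule not_prime_unit[rotated, unfolded not_not] | auto)
  then have "\<not> p dvd c" using assms(1) multiplicity_decompose[of n p] by (simp add: c_def)
  moreover have "q dvd n \<longleftrightarrow> q = p \<and> p dvd n \<or> q dvd c" if "prime q" for q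
  proof (cases "p dvd n")
    case True
    then have "multiplicity p n > 0"
      using assms(1,2) by (simp add: prime_multiplicity_gt_zero_iff)
    then have "q dvd p ^ multiplicity p n \<longleftrightarrow> q = p"
      using that assms(2) by (metis dvd_refl prime_dvd_power_iff primes_dvd_imp_eq)
    moreover have "q dvd n \<longleftrightarrow> q dvd p ^ multiplicity p n \<or> q dvd c"
      using prime_dvd_mult_iff[OF that, of "p ^ multiplicity p n" c] n by simp
    ultimately show ?thesis using True by blast
  next
    case False
    then show ?thesis by (simp add: c_def not_dvd_imp_multiplicity_0)
  qed
  ultimately have "q \<in> prime_factors c \<longleftrightarrow> q \<in> prime_factors n - {p}" for q
    using assms(1) c by (auto simp: in_prime_factors_iff)
  then show "prime_factors c = prime_factors n - {p}" by blast
qed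

section \<open>Sums over prime powers\<close>

definition prime_powers_le :: "real \<Rightarrow> (nat \<times> nat) set" where
  "prime_powers_le x = {(p, j). prime p \<and> j \<ge> 1 \<and> real (p ^ j) \<le> x}"

text \<open>Since \<open>j < 2 ^ j \<le> p ^ j\<close>, both coordinates are at most
  \<open>x\<close>, so sums over prime powers are dominated by iterated sums over a box.\<close>

lemma prime_powers_le_subset:
  assumes "real N \<ge> x"
  shows "prime_powers_le x \<subseteq> primes_le x \<times> {1..N}"
proof clarify
  fix p j assume "(p, j) \<in> prime_powers_le x"
  then have p: "prime p" "j \<ge> 1" "real (p ^ j) \<le> x" by (auto simp: prime_powers_le_def)
  have "p ^ 1 \<le> p ^ j" using p prime_gt_0_nat[of p] by (intro power_increasing) auto
  then have "real p \<le> x" using p(3) by (simp del: of_nat_power add: order_trans[rotated, OF p(3)])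
  moreover have "j \<le> p ^ j" using less_exp[of j] power_mono[of 2 p j] prime_ge_2_nat[OF p(1)] by linarith
  then have "real j \<le> x" using p(3) order_trans of_nat_le_iff by blast
  ultimately show "p \<in> primes_le x \<and> j \<in> {1..N}" using p assms by (auto simp: primes_le_def)
qed

lemma finite_prime_powers_le [simp]: "finite (prime_powers_le x)"
  by (rule finite_subset[OF prime_powers_le_subset[of x "nat \<lceil>x\<rceil>"]]) (auto simp: real_nat_ceiling_ge)

lemma sum_geometric_le:
  assumes "0 \<le> r" "r < (1 :: real)"
  shows "(\<Sum>j\<le>N. r ^ j) \<le> 1 / (1 - r)"
proof -
  have "(\<Sum>j<Suc N. r ^ j) \<le> (\<Sum>j. r ^ j)"
    using assms by (intro sum_le_suminf summable_geometric) auto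
  then show ?thesis using assms by (simp add: suminf_geometric lessThan_Suc_atMost)
qed

lemma sum_prime_powers_le: "(\<Sum>(p, j)\<in>prime_powers_le x. 1 / real (p ^ j)) \<le> pred_prime_sum x"
proof -
  define N where "N = nat \<lceil>x\<rceil>"
  have N: "real N \<ge> x" by (simp add: N_def real_nat_ceiling_ge)
  have "(\<Sum>(p, j)\<in>prime_powers_le x. 1 / real (p ^ j)) \<le> (\<Sum>(p, j)\<in>primes_le x \<times> {1..N}. 1 / real (p ^ j))"
    using prime_powers_le_subset[OF N] by (intro sum_mono2) auto
  also have "\<dots> = (\<Sum>p\<in>primes_le x. \<Sum>j\<in>{1..N}. 1 / real (p ^ j))"
    by (simp add: sum.cartesian_product)
  also have "\<dots> \<le> pred_prime_sum x"
    unfolding pred_prime_sum_def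
  proof (rule sum_mono)
    fix p assume "p \<in> primes_le x"
    then have p: "p > 1" by (auto simp: primes_le_def prime_gt_Suc_0_nat)
    have "(\<Sum>j\<in>{1..N}. 1 / real (p ^ j)) = (\<Sum>j\<le>N. (1 / real p) ^ j) - 1"
      by (simp add: atMost_atLeast0 sum.atLeast_Suc_atMost power_one_over)
    also have "\<dots> \<le> 1 / (1 - 1 / real p) - 1"
      using p by (intro diff_right_mono sum_geometric_le) auto
    also have "\<dots> = 1 / (real p - 1)" using p by (simp add: field_simps)
    finally show "(\<Sum>j\<in>{1..N}. 1 / real (p ^ j)) \<le> 1 / (real p - 1)" .
  qed
  finally show ?thesis .
qed

text \<open>The series of \<open>j / 2 ^ j\<close> from \<open>j = 1\<close> is 2, so 3/2 remains
  from \<open>j = 2\<close>; the subtracted term is the tail beyond \<open>N\<close>.\<close>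

lemma sum_arith_geometric_half:
  "N \<ge> 1 \<Longrightarrow> (\<Sum>j\<in>{2..N}. real j * (1 / 2) ^ j) = 3 / 2 - (real N + 2) * (1 / 2) ^ N"
  by (induction N rule: dec_induct) (auto simp: field_simps)

text \<open>The integral of \<open>ln t / t ^ 2\<close> from \<open>n\<close> to infinity is
  \<open>(ln n + 1) / n\<close>; the extra \<open>1 / n\<close> gives the induction enough slack to
  replace \<open>ln (n + 1)\<close> by \<open>ln n\<close>. The constant 2 gives equality at
  \<open>n = 1\<close>.\<close>

lemma sum_ln_over_square_le:
  "n \<ge> 1 \<Longrightarrow> (\<Sum>m\<in>{2..n}. ln (real m) / real m ^ 2) \<le> 2 - (ln (real n) + 2) / real n"
proof (induction n rule: dec_induct)
  case (step n)
  define L L' where "L = ln (real n)" and "L' = ln (real (Suc n))"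
  have "L' - L = ln (real (Suc n) / real n)"
    using step by (simp add: L_def L'_def ln_div del: of_nat_Suc)
  also have "real (Suc n) / real n = 1 + 1 / real n" using step by (simp add: field_simps)
  also have "ln (1 + 1 / real n) \<le> 1 / real n" using step by (intro ln_add_one_self_le_self) auto
  finally have LL: "L' - L \<le> 1 / real n" .
  have "real n * (L' - L) \<le> 1" using mult_left_mono[OF LL, of "real n"] step by simp
  then have a: "real n * L' \<le> real n * L + 1" by (simp add: algebra_simps)
  have "L' - L \<le> 1" using LL step by (simp add: order_trans[OF LL])
  moreover have "L' \<ge> 0" by (simp add: L'_def)
  ultimately have "L' / real (Suc n) ^ 2 \<le> (L + 1) / (real n * real (Suc n))"
    using step by (intro frac_le) (auto simp: power2_eq_square)
  also have "\<dots> \<le> ((real n + 1) * (L + 2) - real n * (L' + 2)) / (real n * real (Suc n))"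
    using a by (intro divide_right_mono) (auto simp: algebra_simps)
  also have "\<dots> = (L + 2) / real n - (L' + 2) / real (Suc n)"
    using step by (simp add: field_simps)
  finally show ?case using step by (simp add: L_def L'_def del: of_nat_Suc)
qed auto

text \<open>The terms with \<open>j = 1\<close> sum to \<open>theta x \<le> 4 * x\<close>. For
  \<open>j \<ge> 2\<close> the factor \<open>x / p ^ j \<ge> 1\<close> is inserted, and the
  resulting double series contributes at most \<open>6 * x * 2\<close>.\<close>

lemma sum_ln_prime_powers_le:
  assumes "x \<ge> 0"
  shows "(\<Sum>(p, j)\<in>prime_powers_le x. real j * ln (real p)) \<le> 16 * x"
proof (cases "x \<ge> 1")
  case False
  have "1 \<le> real (p ^ j)" if "prime p" for p j :: nat
    using prime_ge_1_nat[OF that] by simp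
  with False have "\<not> real (p ^ j) \<le> x" if "prime p" for p j :: nat
    using that by (meson order_trans)
  then have "prime_powers_le x = {}" by (auto simp: prime_powers_le_def simp del: of_nat_power)
  then show ?thesis using assms by simp
next
  case True
  define N where "N = nat \<lceil>x\<rceil>"
  have N: "real N \<ge> x" by (simp add: N_def real_nat_ceiling_ge)
  moreover have "real N \<ge> 1" using N True by (rule order_trans[rotated])
  ultimately have N: "real N \<ge> x" "N \<ge> 1" by simp_all
  define g where "g p j = (if j = 1 then ln (real p) else real j * ln (real p) * (x / real (p ^ j)))" for p j :: nat
  have g0: "g p j \<ge> 0" if "p \<in> primes_le x" for p j
  proof -
    have "ln (real p) \<ge> 0" using that prime_ge_1_nat[of p] by (simp add: primes_le_def)
    then show ?thesis using assms by (simp add: g_def)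
  qed
  have g1: "real j * ln (real p) \<le> g p j" if "(p, j) \<in> prime_powers_le x" for p j
  proof -
    have p: "prime p" "real (p ^ j) \<le> x" using that by (auto simp: prime_powers_le_def)
    have "real (p ^ j) > 0" using p(1) by (simp add: prime_gt_0_nat)
    with p(2) have "1 \<le> x / real (p ^ j)" by (simp del: of_nat_power)
    from mult_left_mono[OF this, of "real j * ln (real p)"] show ?thesis
      using prime_ge_1_nat[OF p(1)] by (auto simp: g_def)
  qed
  have "(\<Sum>(p, j)\<in>prime_powers_le x. real j * ln (real p)) \<le> (\<Sum>(p, j)\<in>prime_powers_le x. g p j)"
    using g1 by (intro sum_mono) auto
  also have "\<dots> \<le> (\<Sum>(p, j)\<in>primes_le x \<times> {1..N}. g p j)"
    using prime_powers_le_subset[OF N(1)] g0 by (intro sum_mono2) auto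
  also have "\<dots> = (\<Sum>p\<in>primes_le x. \<Sum>j\<in>{1..N}. g p j)"
    by (simp add: sum.cartesian_product)
  also have "\<dots> \<le> (\<Sum>p\<in>primes_le x. ln (real p) + 6 * x * (ln (real p) / real p ^ 2))"
  proof (rule sum_mono)
    fix p assume "p \<in> primes_le x"
    then have p: "p \<ge> 2" by (auto simp: primes_le_def prime_ge_2_nat)
    \<comment> \<open>Keep \<open>p ^ 2\<close> for convergence over the primes and replace the
      other \<open>j - 2\<close> factors \<open>p\<close> by 2. This costs a factor 4, and
      \<open>4 * 3 / 2 = 6\<close>.\<close>
    have "g p j \<le> ln (real p) * x * 4 / real p ^ 2 * (real j * (1 / 2) ^ j)" if j: "j \<in> {2..N}" for j
    proof -
      obtain i where i: "j = i + 2" using j by (metis atLeastAtMost_iff le_add_diff_inverse2)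
      have "g p j = real j * ln (real p) * x / real p ^ 2 * (1 / real p ^ i)"
        using j by (simp add: g_def i power_add power2_eq_square)
      also have "\<dots> \<le> real j * ln (real p) * x / real p ^ 2 * (1 / 2 ^ i)"
        using p assms by (intro mult_left_mono divide_left_mono power_mono) auto
      also have "\<dots> = ln (real p) * x * 4 / real p ^ 2 * (real j * (1 / 2) ^ j)"
        by (simp add: i power_add power_one_over)
      finally show ?thesis .
    qed
    then have "(\<Sum>j\<in>{2..N}. g p j) \<le> (\<Sum>j\<in>{2..N}. ln (real p) * x * 4 / real p ^ 2 * (real j * (1 / 2) ^ j))"
      by (rule sum_mono)
    also have "\<dots> = ln (real p) * x * 4 / real p ^ 2 * (\<Sum>j\<in>{2..N}. real j * (1 / 2) ^ j)"
      by (simp add: sum_distrib_left)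
    also have "\<dots> \<le> ln (real p) * x * 4 / real p ^ 2 * (3 / 2)"
      using p assms by (intro mult_left_mono) (auto simp: sum_arith_geometric_half[OF N(2)])
    finally show "(\<Sum>j\<in>{1..N}. g p j) \<le> ln (real p) + 6 * x * (ln (real p) / real p ^ 2)"
      using N(2) by (simp add: sum.atLeast_Suc_atMost g_def numeral_2_eq_2 algebra_simps)
  qed
  also have "\<dots> = theta x + 6 * x * (\<Sum>p\<in>primes_le x. ln (real p) / real p ^ 2)"
    by (simp add: sum.distrib theta_def sum_distrib_left)
  finally have main: "(\<Sum>(p, j)\<in>prime_powers_le x. real j * ln (real p))
      \<le> theta x + 6 * x * (\<Sum>p\<in>primes_le x. ln (real p) / real p ^ 2)" .
  have "(\<Sum>p\<in>primes_le x. ln (real p) / real p ^ 2) \<le> (\<Sum>m\<in>{2..N}. ln (real m) / real m ^ 2)"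
  proof (intro sum_mono2 subsetI)
    fix p assume "p \<in> primes_le x"
    then have p: "prime p" "real p \<le> x" by (auto simp: primes_le_def)
    then have "real p \<le> real N" using N by linarith
    then show "p \<in> {2..N}" using prime_ge_2_nat[OF p(1)] by auto
  qed auto
  also have "\<dots> \<le> 2 - (ln (real N) + 2) / real N" by (rule sum_ln_over_square_le[OF N(2)])
  also have "\<dots> \<le> 2" using N(2) by (simp add: add_nonneg_nonneg)
  finally have "6 * x * (\<Sum>p\<in>primes_le x. ln (real p) / real p ^ 2) \<le> 6 * x * 2"
    using assms by (intro mult_left_mono) auto
  with main theta_le[OF assms] show ?thesis by simp
qed

section \<open>Euler products over smooth integers\<close>

text \<open>An integer is determined by its exponent at \<open>q\<close> and its cofactor, so the
  sum is at most a geometric sum times a sum over cofactors. The cofactors form a new set, so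
  \<open>A\<close> varies in the induction over \<open>Q\<close>.\<close>

lemma sum_smooth_le_euler_product:
  fixes f :: "nat \<Rightarrow> real"
  assumes mult: "\<And>a b. f (a * b) = f a * f b" and one: "f 1 = 1" and nonneg: "\<And>a. f a \<ge> 0"
    and "finite Q" "\<And>p. p \<in> Q \<Longrightarrow> prime p" "\<And>p. p \<in> Q \<Longrightarrow> f p < 1"
    and "finite A" "\<And>a. a \<in> A \<Longrightarrow> a > 0 \<and> prime_factors a \<subseteq> Q"
  shows "sum f A \<le> (\<Prod>p\<in>Q. 1 / (1 - f p))"
  using assms(4-)
proof (induction Q arbitrary: A)
  case empty
  have "A \<subseteq> {1}"
  proof
    fix a assume "a \<in> A"
    with empty have "a > 0" "prime_factors a = {}" by auto
    then show "a \<in> {1}" by (simp add: prime_factorization_empty_iff)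
  qed
  then have "sum f A \<le> sum f {1}" by (intro sum_mono2) (auto simp: nonneg)
  then show ?case using one by simp
next
  case (insert q Q)
  have q: "prime q" "f q < 1" using insert.prems by auto
  define \<nu> c where "\<nu> a = multiplicity q a" and "c a = a div q ^ \<nu> a" for a
  define N where "N = Max (insert 0 (\<nu> ` A))"
  have \<nu>: "\<nu> a \<le> N" if "a \<in> A" for a using that insert.prems by (auto simp: N_def intro!: Max_ge)
  have dec: "a = q ^ \<nu> a * c a" "c a > 0" "prime_factors (c a) = prime_factors a - {q}" if "a \<in> A" for a
    using prime_power_decompose[of a q] insert.prems(4)[OF that] q by (auto simp: \<nu>_def c_def)
  have pow: "f (q ^ j) = f q ^ j" for j by (induction j) (auto simp: mult one[simplified])
  have inj: "inj_on (\<lambda>a. (\<nu> a, c a)) A" 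
  proof (rule inj_onI)
    fix a b assume "a \<in> A" "b \<in> A" "(\<nu> a, c a) = (\<nu> b, c b)"
    then show "a = b" using dec(1)[of a] dec(1)[of b] by simp
  qed
  have fa: "f a = f q ^ \<nu> a * f (c a)" if "a \<in> A" for a
    using arg_cong[OF dec(1)[OF that], of f] by (simp add: mult pow)
  have "sum f A = (\<Sum>a\<in>A. f q ^ \<nu> a * f (c a))"
    by (intro sum.cong refl fa)
  also have "\<dots> = (\<Sum>(j, b)\<in>(\<lambda>a. (\<nu> a, c a)) ` A. f q ^ j * f b)"
    by (simp add: sum.reindex[OF inj])
  also have "\<dots> \<le> (\<Sum>(j, b)\<in>{..N} \<times> c ` A. f q ^ j * f b)"
    using \<nu> insert.prems by (intro sum_mono2) (auto simp: nonneg)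
  also have "\<dots> = (\<Sum>j\<le>N. f q ^ j) * sum f (c ` A)"
    by (simp add: sum_product sum.cartesian_product)
  also have "\<dots> \<le> 1 / (1 - f q) * (\<Prod>p\<in>Q. 1 / (1 - f p))"
  proof (rule mult_mono)
    show "sum f (c ` A) \<le> (\<Prod>p\<in>Q. 1 / (1 - f p))"
    proof (rule insert.IH)
      fix b assume "b \<in> c ` A"
      then obtain a where "a \<in> A" "b = c a" by auto
      then show "b > 0 \<and> prime_factors b \<subseteq> Q" using dec(2,3) insert.prems(4)[of a] by auto
    qed (use insert.prems in auto)
  qed (use q nonneg in \<open>auto intro!: sum_geometric_le sum_nonneg\<close>)
  finally show ?case using insert.hyps by simp
qed

text \<open>Each Euler factor is \<open>1 + f p / (1 - f p) \<le> exp (k / (p - 1))\<close>. This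
  serves with \<open>k = 1\<close> for reciprocals and \<open>k = 3\<close> for the Rankin
  weight.\<close>

lemma sum_smooth_le_exp:
  fixes f :: "nat \<Rightarrow> real"
  assumes "\<And>a b. f (a * b) = f a * f b" "f 1 = 1" "\<And>a. f a \<ge> 0"
    and p: "\<And>p. p \<in> primes_le T \<Longrightarrow> f p < 1 \<and> f p / (1 - f p) \<le> k / (real p - 1)"
    and "finite A" "\<And>a. a \<in> A \<Longrightarrow> a > 0 \<and> prime_factors a \<subseteq> primes_le T"
  shows "sum f A \<le> exp (k * pred_prime_sum T)"
proof -
  have "sum f A \<le> (\<Prod>p\<in>primes_le T. 1 / (1 - f p))"
    using assms by (intro sum_smooth_le_euler_product) (auto simp: primes_le_def)
  also have "\<dots> \<le> (\<Prod>p\<in>primes_le T. exp (k / (real p - 1)))"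
  proof (intro prod_mono conjI)
    fix p assume "p \<in> primes_le T"
    note * = p[OF this]
    then show "0 \<le> 1 / (1 - f p)" by auto
    have "1 / (1 - f p) = 1 + f p / (1 - f p)" using * by (simp add: field_simps)
    also have "\<dots> \<le> 1 + k / (real p - 1)" using * by simp
    also have "\<dots> \<le> exp (k / (real p - 1))" by (rule exp_ge_add_one_self)
    finally show "1 / (1 - f p) \<le> exp (k / (real p - 1))" .
  qed
  also have "\<dots> = exp (k * pred_prime_sum T)"
    by (simp add: exp_sum[symmetric] pred_prime_sum_def sum_distrib_left)
  finally show ?thesis .
qed

section \<open>Integers with few large prime factors\<close>

definition rough_primes :: "real \<Rightarrow> nat \<Rightarrow> nat set" where
  "rough_primes T n = {p \<in> prime_factors n. real p > T}"

lemma finite_rough_primes [simp]: "finite (rough_primes T n)"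
  by (simp add: rough_primes_def)

definition few_rough_primes :: "real \<Rightarrow> nat \<Rightarrow> real \<Rightarrow> nat set" where
  "few_rough_primes T m x = {n. 1 \<le> n \<and> real n \<le> x \<and> card (rough_primes T n) \<le> m}"

lemma finite_few_rough_primes [simp]: "finite (few_rough_primes T m x)"
  by (rule finite_subset[OF _ finite_nat_le[of x]]) (auto simp: few_rough_primes_def)

text \<open>With \<open>c\<close> fixed, the removed prime power runs up to \<open>x / c\<close>.
  The Chebyshev-type bound later sums over this sharp range, while the recursion for reciprocals
  only keeps \<open>p ^ j \<le> x\<close>.\<close>

lemma few_rough_primes_remove:
  assumes "n \<in> few_rough_primes T (Suc m) x" "p \<in> rough_primes T n"
  defines "j \<equiv> multiplicity p n"
  defines "c \<equiv> n div p ^ j"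
  shows "n = p ^ j * c" "c \<in> few_rough_primes T m x" "(p, j) \<in> prime_powers_le (x / real c)"
proof -
  have p: "prime p" "p \<in> prime_factors n" "n > 0" using assms by (auto simp: rough_primes_def few_rough_primes_def)
  note d = prime_power_decompose[OF p(3,1), folded j_def, folded c_def]
  show n: "n = p ^ j * c" by (rule d(1))
  have j: "j \<ge> 1" using p by (simp add: j_def prime_factors_multiplicity)
  have nx: "real n \<le> x" using assms(1) by (simp add: few_rough_primes_def)
  have "real (p ^ j) * real c \<le> x" using nx n by (metis of_nat_mult)
  then show "(p, j) \<in> prime_powers_le (x / real c)"
    using p j d(2) by (simp add: prime_powers_le_def pos_le_divide_eq)
  have "rough_primes T c = rough_primes T n - {p}" using d(3) by (auto simp: rough_primes_def)
  then have "card (rough_primes T c) \<le> m"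
    using assms(1,2) by (simp add: few_rough_primes_def) linarith
  moreover have "c \<le> n" using n p(3) by (metis d(2) dvd_imp_le dvd_triv_right)
  ultimately show "c \<in> few_rough_primes T m x"
    using d(2) nx by (simp add: few_rough_primes_def)
qed

lemma sum_inverse_few_rough_primes_0:
  "(\<Sum>n\<in>few_rough_primes T 0 x. 1 / real n) \<le> exp (pred_prime_sum T)"
proof -
  have "(\<Sum>n\<in>few_rough_primes T 0 x. 1 / real n) \<le> exp (1 * pred_prime_sum T)"
  proof (rule sum_smooth_le_exp)
    fix p assume "p \<in> primes_le T"
    then have "real p > 1" by (auto simp: primes_le_def prime_gt_Suc_0_nat)
    then show "1 / real p < 1 \<and> 1 / real p / (1 - 1 / real p) \<le> 1 / (real p - 1)"
      by (simp add: field_simps)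
  qed (auto simp: few_rough_primes_def rough_primes_def primes_le_def not_less)
  then show ?thesis by simp
qed

text \<open>If \<open>n\<close> has exactly \<open>m + 1\<close> primes above \<open>T\<close>, any
  of them gives \<open>n = p ^ j * c\<close> with \<open>c\<close> in the smaller class. Different
  choices may give the same \<open>n\<close>, which only enlarges the bound. The 1 in the factor
  accounts for the \<open>n\<close> already in the smaller class.\<close>

lemma sum_inverse_few_rough_primes_Suc:
  "(\<Sum>n\<in>few_rough_primes T (Suc m) x. 1 / real n)
    \<le> (1 + pred_prime_sum x) * (\<Sum>n\<in>few_rough_primes T m x. 1 / real n)"
proof -
  let ?C = "few_rough_primes T m x" and ?C' = "few_rough_primes T (Suc m) x"
  let ?h = "\<lambda>((p, j), c). p ^ j * c :: nat"
  let ?I = "prime_powers_le x \<times> ?C"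
  have "?C' - ?C \<subseteq> ?h ` ?I"
  proof
    fix n assume n: "n \<in> ?C' - ?C"
    then have "card (rough_primes T n) = Suc m" by (auto simp: few_rough_primes_def)
    then obtain p where p: "p \<in> rough_primes T n" by fastforce
    define j c where "j = multiplicity p n" and "c = n div p ^ j"
    have r: "n = p ^ j * c" "c \<in> ?C" "(p, j) \<in> prime_powers_le (x / real c)"
      using few_rough_primes_remove[of n T m x p] n p by (auto simp: j_def c_def)
    have "c \<ge> 1" "x \<ge> 0" using r(2) by (auto simp: few_rough_primes_def)
    then have "x / real c \<le> x" by (simp add: divide_le_eq mult_le_cancel_left1)
    then have "(p, j) \<in> prime_powers_le x" using r(3) by (auto simp: prime_powers_le_def)
    with r show "n \<in> ?h ` ?I" by force
  qed
  then have "(\<Sum>n\<in>?C' - ?C. 1 / real n) \<le> (\<Sum>n\<in>?h ` ?I. 1 / real n)"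
    by (intro sum_mono2) auto
  also have "\<dots> \<le> (\<Sum>i\<in>?I. 1 / real (?h i))"
    using sum_image_le[of ?I "\<lambda>n. 1 / real n" ?h] by simp
  also have "\<dots> = (\<Sum>(p, j)\<in>prime_powers_le x. 1 / real (p ^ j)) * (\<Sum>n\<in>?C. 1 / real n)"
    by (simp add: sum_product sum.cartesian_product case_prod_unfold)
  also have "\<dots> \<le> pred_prime_sum x * (\<Sum>n\<in>?C. 1 / real n)"
    by (intro mult_right_mono sum_prime_powers_le sum_nonneg) auto
  finally have "(\<Sum>n\<in>?C' - ?C. 1 / real n) \<le> pred_prime_sum x * (\<Sum>n\<in>?C. 1 / real n)" .
  moreover have "(\<Sum>n\<in>?C'. 1 / real n) = (\<Sum>n\<in>?C' - ?C. 1 / real n) + (\<Sum>n\<in>?C. 1 / real n)"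
    by (rule sum.subset_diff) (auto simp: few_rough_primes_def)
  ultimately show ?thesis by (simp add: algebra_simps)
qed

lemma pred_prime_sum_nonneg: "pred_prime_sum x \<ge> 0"
  unfolding pred_prime_sum_def by (intro sum_nonneg) (auto simp: primes_le_def dest: prime_ge_1_nat)

text \<open>Iterating the recursion down to the smooth integers; by Mertens' bound the right side
  has order at most \<open>ln (ln x) ^ m * ln T\<close>.\<close>

lemma sum_inverse_few_rough_primes_le:
  "(\<Sum>n\<in>few_rough_primes T m x. 1 / real n) \<le> (1 + pred_prime_sum x) ^ m * exp (pred_prime_sum T)"
proof (induction m)
  case 0
  then show ?case using sum_inverse_few_rough_primes_0 by simp
next
  case (Suc m)
  have "(\<Sum>n\<in>few_rough_primes T (Suc m) x. 1 / real n)
      \<le> (1 + pred_prime_sum x) * (\<Sum>n\<in>few_rough_primes T m x. 1 / real n)"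
    by (rule sum_inverse_few_rough_primes_Suc)
  also have "\<dots> \<le> (1 + pred_prime_sum x) * ((1 + pred_prime_sum x) ^ m * exp (pred_prime_sum T))"
    using Suc pred_prime_sum_nonneg[of x] by (intro mult_left_mono) auto
  finally show ?case by (simp add: mult.assoc)
qed

section \<open>The average logarithm of the rough part\<close>

definition ln_rough_part :: "real \<Rightarrow> nat \<Rightarrow> real" where
  "ln_rough_part T n = (\<Sum>p\<in>rough_primes T n. real (multiplicity p n) * ln (real p))"

text \<open>Every pair of \<open>n\<close> and a prime power \<open>p ^ j\<close> exactly dividing it is recovered from
  \<open>n div p ^ j\<close> and \<open>(p, j)\<close>, and dividing out \<open>p ^ j\<close> removes exactly one large prime.\<close>

lemma sum_ln_rough_part_le:
  "(\<Sum>n\<in>few_rough_primes T (Suc m) x. ln_rough_part T n)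
    \<le> 16 * x * (\<Sum>c\<in>few_rough_primes T m x. 1 / real c)"
proof (cases "x \<ge> 0")
  case False
  then have "few_rough_primes T k x = {}" for k by (auto simp: few_rough_primes_def)
  then show ?thesis by simp
next
  case True
  let ?C = "few_rough_primes T m x" and ?C' = "few_rough_primes T (Suc m) x"
  let ?I = "Sigma ?C' (rough_primes T)" and ?J = "Sigma ?C (\<lambda>c. prime_powers_le (x / real c))"
  let ?h = "\<lambda>(n, p). (n div p ^ multiplicity p n, (p, multiplicity p n))"
  have r: "n = p ^ multiplicity p n * (n div p ^ multiplicity p n)" "?h (n, p) \<in> ?J"
    if "(n, p) \<in> ?I" for n p
    using few_rough_primes_remove[of n T m x p] that by auto
  have inj: "inj_on ?h ?I"
  proof (rule inj_onI)
    fix u v assume uv: "u \<in> ?I" "v \<in> ?I" "?h u = ?h v"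
    obtain n p n' p' where [simp]: "u = (n, p)" "v = (n', p')" by (metis surj_pair)
    have "n = n'" using r(1)[of n p] r(1)[of n' p'] uv by auto
    then show "u = v" using uv by simp
  qed
  have "(\<Sum>n\<in>?C'. ln_rough_part T n) = (\<Sum>(n, p)\<in>?I. real (multiplicity p n) * ln (real p))"
    unfolding ln_rough_part_def by (subst sum.Sigma) auto
  also have "\<dots> = (\<Sum>(c, p, j)\<in>?h ` ?I. real j * ln (real p))"
    by (subst sum.reindex[OF inj]) (auto intro!: sum.cong)
  also have "\<dots> \<le> (\<Sum>(c, p, j)\<in>?J. real j * ln (real p))"
  proof (intro sum_mono2 image_subsetI)
    fix u assume "u \<in> ?I"
    then show "?h u \<in> ?J" using r(2) by (cases u) blast
  next
    fix u assume "u \<in> ?J - ?h ` ?I"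
    then show "0 \<le> (case u of (c, p, j) \<Rightarrow> real j * ln (real p))"
      by (auto simp: prime_powers_le_def dest: prime_ge_1_nat)
  qed auto
  also have "\<dots> = (\<Sum>c\<in>?C. \<Sum>(p, j)\<in>prime_powers_le (x / real c). real j * ln (real p))"
    by (subst sum.Sigma) auto
  also have "\<dots> \<le> (\<Sum>c\<in>?C. 16 * (x / real c))"
    using True by (intro sum_mono sum_ln_prime_powers_le) auto
  also have "\<dots> = 16 * x * (\<Sum>c\<in>?C. 1 / real c)" by (simp add: sum_distrib_left)
  finally show ?thesis .
qed

section \<open>The smooth part and Rankin's trick\<close>

definition smooth_part :: "real \<Rightarrow> nat \<Rightarrow> nat" where
  "smooth_part T n = (\<Prod>p\<in>prime_factors n - rough_primes T n. p ^ multiplicity p n)"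

lemma smooth_part:
  assumes "n > 0"
  shows "smooth_part T n dvd n" "smooth_part T n > 0" "prime_factors (smooth_part T n) \<subseteq> primes_le T"
    "ln (real n) = ln (real (smooth_part T n)) + ln_rough_part T n"
proof -
  let ?s = "\<lambda>A. \<Prod>p\<in>A. p ^ multiplicity p n"
  have pos: "p > 0" if "p \<in> prime_factors n" for p using that by (simp add: in_prime_factors_iff prime_gt_0_nat)
  have n: "n = ?s (prime_factors n)" using assms by (simp add: prime_factorization_nat)
  show 1: "smooth_part T n dvd n"
    unfolding smooth_part_def by (subst (4) n, rule prod_dvd_prod_subset) auto
  show 2: "smooth_part T n > 0" using 1 assms by (auto intro: Nat.gr0I)
  show "prime_factors (smooth_part T n) \<subseteq> primes_le T"
  proof
    fix q assume "q \<in> prime_factors (smooth_part T n)"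
    then have q: "prime q" "q dvd smooth_part T n" by auto
    then obtain p where p: "p \<in> prime_factors n - rough_primes T n" "q dvd p ^ multiplicity p n"
      unfolding smooth_part_def by (subst (asm) prime_dvd_prod_iff) auto
    then have "q = p" using q(1) by (metis DiffD1 in_prime_factors_iff prime_dvd_power primes_dvd_imp_eq)
    then show "q \<in> primes_le T" using p(1) by (auto simp: rough_primes_def primes_le_def)
  qed
  have ln: "ln (real (?s A)) = (\<Sum>p\<in>A. real (multiplicity p n) * ln (real p))"
    if "A \<subseteq> prime_factors n" for A
  proof -
    have "finite A" using that finite_subset by blast
    moreover have "real p ^ multiplicity p n > 0" if "p \<in> A" for p
      using that \<open>A \<subseteq> prime_factors n\<close> pos by auto
    ultimately have "ln (real (?s A)) = (\<Sum>p\<in>A. ln (real p ^ multiplicity p n))"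
      by (simp add: ln_prod)
    also have "\<dots> = (\<Sum>p\<in>A. real (multiplicity p n) * ln (real p))"
      using that pos by (intro sum.cong refl ln_realpow)
    finally show ?thesis .
  qed
  have "ln (real n) = (\<Sum>p\<in>prime_factors n. real (multiplicity p n) * ln (real p))"
    using ln[of "prime_factors n"] n by simp
  also have "\<dots> = (\<Sum>p\<in>prime_factors n - rough_primes T n. real (multiplicity p n) * ln (real p)) + ln_rough_part T n"
    unfolding ln_rough_part_def by (rule sum.subset_diff) (auto simp: rough_primes_def)
  also have "(\<Sum>p\<in>prime_factors n - rough_primes T n. real (multiplicity p n) * ln (real p))
      = ln (real (smooth_part T n))"
    unfolding smooth_part_def by (rule ln[symmetric]) auto
  finally show "ln (real n) = ln (real (smooth_part T n)) + ln_rough_part T n" .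
qed

lemma card_multiples_le:
  fixes a :: nat
  assumes "a > 0" "x \<ge> 0"
  shows "real (card {n. 1 \<le> n \<and> real n \<le> x \<and> a dvd n}) \<le> x / real a"
proof -
  let ?N = "nat \<lfloor>x / real a\<rfloor>"
  have "{n. 1 \<le> n \<and> real n \<le> x \<and> a dvd n} \<subseteq> (\<lambda>i. a * i) ` {1..?N}"
  proof
    fix n assume "n \<in> {n. 1 \<le> n \<and> real n \<le> x \<and> a dvd n}"
    then obtain i where n: "n = a * i" and i: "1 \<le> a * i" "real (a * i) \<le> x" by (auto elim: dvdE)
    then have "real i \<le> x / real a" using assms by (simp add: field_simps)
    then have "i \<le> ?N" by (rule le_nat_floor)
    moreover have "1 \<le> i" using i(1) by (cases i) auto
    ultimately show "n \<in> (\<lambda>i. a * i) ` {1..?N}" using n by auto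
  qed
  then have "card {n. 1 \<le> n \<and> real n \<le> x \<and> a dvd n} \<le> card {1..?N}"
    by (intro surj_card_le) auto
  then have "real (card {n. 1 \<le> n \<and> real n \<le> x \<and> a dvd n}) \<le> real ?N" by simp
  also have "\<dots> \<le> x / real a" using assms by (intro of_nat_floor) auto
  finally show ?thesis .
qed

text \<open>Rankin's trick with the exponent \<open>\<sigma> = ln (3/2) / ln T\<close>: then \<open>p powr \<sigma> \<le> 3/2 < p\<close>
  for all primes \<open>p \<le> T\<close>, so that the Euler product converges even at \<open>p = 2\<close>.\<close>

lemma card_large_smooth_part_le:
  assumes "T \<ge> 2" "x \<ge> 1" "y > 0"
  shows "real (card {n. 1 \<le> n \<and> real n \<le> x \<and> real (smooth_part T n) > y})
    \<le> x * exp (3 * pred_prime_sum T) * exp (- ln (3 / 2) * ln y / ln T)"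
proof -
  define \<sigma> where "\<sigma> = ln (3 / 2) / ln T"
  define A where "A = {a. a > 0 \<and> real a \<le> x \<and> real a > y \<and> prime_factors a \<subseteq> primes_le T}"
  define S where "S = {n. 1 \<le> n \<and> real n \<le> x \<and> real (smooth_part T n) > y}"
  have T: "ln T > 0" using assms by simp
  have \<sigma>: "\<sigma> \<ge> 0" using T by (simp add: \<sigma>_def)
  have finA: "finite A" by (rule finite_subset[OF _ finite_nat_le[of x]]) (auto simp: A_def)
  \<comment> \<open>Each counted \<open>n\<close> is a multiple of its own smooth part, which lies
    in \<open>A\<close>.\<close>
  have "S \<subseteq> (\<Union>a\<in>A. {n. 1 \<le> n \<and> real n \<le> x \<and> a dvd n})"
  proof
    fix n assume n: "n \<in> S"
    then have "n > 0" "real n \<le> x" by (auto simp: S_def)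
    note s = smooth_part[OF this(1), of T]
    have "real (smooth_part T n) \<le> real n" using s(1) \<open>n > 0\<close> by (simp add: dvd_imp_le)
    then have "smooth_part T n \<in> A" using n s by (auto simp: A_def S_def)
    with n s(1) show "n \<in> (\<Union>a\<in>A. {n. 1 \<le> n \<and> real n \<le> x \<and> a dvd n})" by (auto simp: S_def)
  qed
  then have "card S \<le> card (\<Union>a\<in>A. {n. 1 \<le> n \<and> real n \<le> x \<and> a dvd n})"
    by (rule card_mono[rotated]) (auto intro!: finA finite_subset[OF _ finite_nat_le[of x]])
  also have "\<dots> \<le> (\<Sum>a\<in>A. card {n. 1 \<le> n \<and> real n \<le> x \<and> a dvd n})"
    by (rule card_UN_le[OF finA])
  finally have "real (card S) \<le> (\<Sum>a\<in>A. real (card {n. 1 \<le> n \<and> real n \<le> x \<and> a dvd n}))"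
    by (metis of_nat_le_iff of_nat_sum)
  also have "\<dots> \<le> (\<Sum>a\<in>A. x / real a)"
    using assms by (intro sum_mono card_multiples_le) (auto simp: A_def)
  \<comment> \<open>Rankin's step: \<open>a > y\<close> makes the inserted factor
    \<open>(a / y) powr \<sigma>\<close> at least 1.\<close>
  also have "\<dots> \<le> (\<Sum>a\<in>A. x * y powr (- \<sigma>) * (real a powr (\<sigma> - 1)))"
  proof (rule sum_mono)
    fix a assume "a \<in> A"
    then have a: "real a > y" "real a > 0" by (auto simp: A_def)
    have "1 = y powr (-\<sigma>) * y powr \<sigma>" using assms by (simp flip: powr_add)
    also have "\<dots> \<le> y powr (- \<sigma>) * real a powr \<sigma>"
      using a assms \<sigma> by (intro mult_left_mono powr_mono2) auto
    finally have "x / real a * 1 \<le> x / real a * (y powr (- \<sigma>) * real a powr \<sigma>)"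
      using a assms by (intro mult_left_mono) auto
    also have "real a powr \<sigma> = real a * real a powr (\<sigma> - 1)"
      using a by (simp add: powr_diff)
    finally show "x / real a \<le> x * y powr (- \<sigma>) * (real a powr (\<sigma> - 1))"
      using a by (simp add: mult_ac)
  qed
  also have "\<dots> = x * y powr (- \<sigma>) * (\<Sum>a\<in>A. real a powr (\<sigma> - 1))"
    by (simp add: sum_distrib_left)
  also have "(\<Sum>a\<in>A. real a powr (\<sigma> - 1)) \<le> exp (3 * pred_prime_sum T)"
  proof (rule sum_smooth_le_exp)
    fix p assume "p \<in> primes_le T"
    then have "prime p" and pT: "real p \<le> T" by (auto simp: primes_le_def)
    then have p: "real p \<ge> 2" using prime_ge_2_nat[of p] by simp
    have "real p powr \<sigma> \<le> T powr \<sigma>" using p pT \<sigma> by (intro powr_mono2) auto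
    also have "\<dots> = 3 / 2" using assms T by (simp add: powr_def \<sigma>_def)
    finally have "real p * real p powr (\<sigma> - 1) \<le> 3 / 2" using p by (simp add: powr_diff)
    then have u: "real p powr (\<sigma> - 1) \<le> (3 / 2) / real p" using p by (simp add: field_simps)
    have "(3 / 2) / real p < 1" using p by simp
    with u have u1: "real p powr (\<sigma> - 1) < 1" by linarith
    have "real p powr (\<sigma> - 1) / (1 - real p powr (\<sigma> - 1)) \<le> ((3 / 2) / real p) / (1 - (3 / 2) / real p)"
      using u p by (intro frac_le) auto
    also have "\<dots> = (3 / 2) / (real p - 3 / 2)" using p by (simp add: field_simps)
    \<comment> \<open>For \<open>p \<ge> 2\<close> one has
      \<open>p - 3 / 2 \<ge> (p - 1) / 2\<close>, with equality at 2; this yields the constant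
      3.\<close>
    also have "\<dots> \<le> (3 / 2) / ((real p - 1) / 2)" using p by (intro divide_left_mono) auto
    finally show "real p powr (\<sigma> - 1) < 1 \<and>
        real p powr (\<sigma> - 1) / (1 - real p powr (\<sigma> - 1)) \<le> 3 / (real p - 1)"
      using u1 by simp
  qed (auto simp: powr_mult finA, auto simp: A_def)
  finally have "real (card S) \<le> x * y powr (- \<sigma>) * exp (3 * pred_prime_sum T)"
    using assms by (simp add: mult_left_mono)
  also have "y powr (- \<sigma>) = exp (- ln (3 / 2) * ln y / ln T)"
    using assms by (simp add: powr_def \<sigma>_def)
  finally show ?thesis by (simp add: S_def mult_ac)
qed

text \<open>The three terms count the \<open>n \<le> x powr (3 / 4)\<close>, the \<open>n\<close>
  with smooth part above \<open>sqrt x\<close>, and the rest. In the rest the rough part has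
  logarithm at least \<open>(3 / 4 - 1 / 2) * ln x\<close>, so Markov's inequality turns the average
  bound with constant 16 into 64.\<close>

lemma card_few_rough_primes_le:
  assumes "T \<ge> 2" "x > 1"
  shows "real (card (few_rough_primes T (Suc m) x)) \<le> x powr (3 / 4)
    + x * exp (3 * pred_prime_sum T) * exp (- (ln (3 / 2) / 2) * (ln x / ln T))
    + 64 * x / ln x * ((1 + pred_prime_sum x) ^ m * exp (pred_prime_sum T))"
proof -
  let ?C = "few_rough_primes T (Suc m) x"
  define S1 where "S1 = {n. 1 \<le> n \<and> real n \<le> x powr (3 / 4)}"
  define S2 where "S2 = {n. 1 \<le> n \<and> real n \<le> x \<and> real (smooth_part T n) > sqrt x}"
  define S3 where "S3 = ?C - S1 - S2"
  have fin: "finite S1" "finite S2" "finite S3"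
    by (auto simp: S1_def S2_def S3_def intro: finite_subset[OF _ finite_nat_le])
  have lnx: "ln x > 0" using assms by simp
  have "real (card S1) \<le> x powr (3 / 4) / real 1"
    using card_multiples_le[of 1 "x powr (3/4)"] by (simp add: S1_def)
  moreover have "real (card S2) \<le> x * exp (3 * pred_prime_sum T) * exp (- (ln (3 / 2) / 2) * (ln x / ln T))"
    using card_large_smooth_part_le[of T x "sqrt x"] assms by (simp add: S2_def ln_sqrt)
  moreover have "real (card S3) \<le> 64 * x / ln x * ((1 + pred_prime_sum x) ^ m * exp (pred_prime_sum T))"
  proof -
    have "ln x / 4 \<le> ln_rough_part T n" if "n \<in> S3" for n
    proof -
      have n: "n > 0" "real n > x powr (3 / 4)" "real (smooth_part T n) \<le> sqrt x"
        using that by (auto simp: S3_def S1_def S2_def few_rough_primes_def)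
      note s = smooth_part[OF n(1), of T]
      have "ln (x powr (3 / 4)) \<le> ln (real n)" using n assms by (subst ln_le_cancel_iff) auto
      then have "3 / 4 * ln x \<le> ln (real n)" using assms by (simp add: ln_powr)
      moreover have "ln (real (smooth_part T n)) \<le> ln (sqrt x)"
        using n s assms by (subst ln_le_cancel_iff) auto
      then have "ln (real (smooth_part T n)) \<le> ln x / 2" using assms by (simp add: ln_sqrt)
      ultimately show ?thesis using s(4) by linarith
    qed
    then have "real (card S3) * (ln x / 4) \<le> (\<Sum>n\<in>S3. ln_rough_part T n)"
      using sum_bounded_below[of S3 "ln x / 4"] by simp
    also have "\<dots> \<le> (\<Sum>n\<in>?C. ln_rough_part T n)"
    proof (rule sum_mono2)
      fix n show "ln_rough_part T n \<ge> 0" unfolding ln_rough_part_def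
        by (intro sum_nonneg mult_nonneg_nonneg ln_ge_zero)
          (auto simp: rough_primes_def in_prime_factors_iff Suc_le_eq prime_gt_0_nat)
    qed (auto simp: S3_def)
    also have "\<dots> \<le> 16 * x * (\<Sum>c\<in>few_rough_primes T m x. 1 / real c)"
      by (rule sum_ln_rough_part_le)
    also have "\<dots> \<le> 16 * x * ((1 + pred_prime_sum x) ^ m * exp (pred_prime_sum T))"
      using assms by (intro mult_left_mono sum_inverse_few_rough_primes_le) auto
    finally show ?thesis using lnx by (simp add: field_simps)
  qed
  moreover have "?C \<subseteq> S1 \<union> S2 \<union> S3" by (auto simp: S3_def)
  then have "card ?C \<le> card S1 + card S2 + card S3"
    by (meson card_Un_le card_mono fin finite_UnI add_le_mono1 order_trans)
  then have "real (card ?C) \<le> real (card S1) + real (card S2) + real (card S3)"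
    by (metis of_nat_add of_nat_le_iff)
  ultimately show ?thesis by linarith
qed

section \<open>The counting function\<close>

text \<open>In the decreasing list the \<open>k\<close>-th largest prime sits at position
  \<open>k - 1\<close>. Once it is at most \<open>T\<close>, all primes above \<open>T\<close> lie
  strictly before it; a shorter list has at most \<open>k - 1\<close> entries anyway.\<close>

lemma card_rough_primes_le:
  assumes "k \<ge> 1" "real (P k n) \<le> T"
  shows "card (rough_primes T n) \<le> k - 1"
proof -
  define qs where "qs = rev (sorted_list_of_set (prime_factors n))"
  have set: "set qs = prime_factors n" and dist: "distinct qs" and sorted: "sorted (rev qs)"
    by (auto simp: qs_def)
  show ?thesis
  proof (cases "k \<le> length qs")
    case True
    then have le: "real (qs ! (k - 1)) \<le> T" using assms by (simp add: P_def qs_def Let_def)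
    have "rough_primes T n \<subseteq> set (take (k - 1) qs)"
    proof
      fix q assume q: "q \<in> rough_primes T n"
      then obtain i where i: "i < length qs" "q = qs ! i"
        by (metis (no_types, lifting) in_set_conv_nth mem_Collect_eq rough_primes_def set)
      have "i < k - 1"
      proof (rule ccontr)
        assume "\<not> i < k - 1"
        then have "qs ! i \<le> qs ! (k - 1)" using sorted i(1) by (intro sorted_rev_nth_mono) auto
        with le i q show False by (simp add: rough_primes_def)
      qed
      with i show "q \<in> set (take (k - 1) qs)"
        using in_set_conv_nth[of q "take (k - 1) qs"] by auto
    qed
    then have "card (rough_primes T n) \<le> card (set (take (k - 1) qs))" by (intro card_mono) auto
    also have "\<dots> \<le> length (take (k - 1) qs)" by (rule card_length)
    also have "\<dots> \<le> k - 1" by simp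
    finally show ?thesis .
  next
    case False
    have "card (rough_primes T n) \<le> card (set qs)"
      by (intro card_mono) (auto simp: rough_primes_def set)
    also have "\<dots> = length qs" by (rule distinct_card[OF dist])
    finally show ?thesis using False by simp
  qed
qed

lemma Psi_le_card_few_rough_primes:
  assumes "k \<ge> 1"
  shows "Psi k x T \<le> card (few_rough_primes T (k - 1) x)"
  unfolding Psi_def using card_rough_primes_le[OF assms]
  by (intro card_mono) (auto simp: few_rough_primes_def)

text \<open>With \<open>m = k - 2\<close>, each of the three terms of the count is compared with the
  target \<open>B\<close>, and \<open>C\<close> adds the three resulting constants.\<close>

lemma Psi_le:
  fixes \<delta> :: real
  assumes k: "k \<ge> 2" and \<delta>: "\<delta> > 0"
  shows "\<exists>C>0. \<forall>\<^sub>F x in at_top. \<forall>T. 2 \<le> T \<and> T \<le> exp (ln x powr (1 - \<delta>)) \<longrightarrow>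
    real (Psi k x T) \<le> C * (x * ln (ln x) ^ (k - 2) * ln T / ln x)"
proof -
  define m where "m = k - 2"
  obtain c0 where c0: "\<And>x. x \<ge> 2 \<Longrightarrow> pred_prime_sum x \<le> ln (ln x) + c0" using pred_prime_sum_le by blast
  \<comment> \<open>With \<open>c \<ge> 0\<close>, the condition
    \<open>ln (ln x) \<ge> 1 + c\<close> gives both \<open>ln (ln x) \<ge> 1\<close> and
    \<open>1 + pred_prime_sum x \<le> 2 * ln (ln x)\<close>.\<close>
  define c where "c = max c0 0"
  have c: "pred_prime_sum x \<le> ln (ln x) + c" if "x \<ge> 2" for x
    using c0[OF that] by (simp add: c_def)
  define d :: real where "d = ln (3 / 2) / 2"
  have d: "d > 0" by (simp add: d_def)
  define C where "C = 1 / ln 2 + exp (3 * c) + 64 * 2 ^ m * exp c"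
  have "\<forall>\<^sub>F x :: real in at_top. x \<ge> 2" by (rule eventually_ge_at_top)
  moreover have "\<forall>\<^sub>F x :: real in at_top. ln (ln x) \<ge> 1 + c" by real_asymp
  moreover have "\<forall>\<^sub>F x :: real in at_top. ln x \<ge> 1" by real_asymp
  moreover have "\<forall>\<^sub>F x :: real in at_top. x powr (3 / 4) \<le> x / ln x" by real_asymp
  \<comment> \<open>Two powers of \<open>ln x\<close> will pay for \<open>(ln T) ^ 2\<close> and the
    third for the denominator of the target. In the variable \<open>y = ln x powr \<delta>\<close>
    this is a power against an exponential.\<close>
  moreover have "\<forall>\<^sub>F x :: real in at_top. ln x ^ 3 * exp (- d * ln x powr \<delta>) \<le> 1"
  proof -
    have "\<forall>\<^sub>F y :: real in at_top. y powr (3 / \<delta>) * exp (- d * y) \<le> 1" using d \<delta> by real_asymp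
    moreover have "filterlim (\<lambda>x :: real. ln x powr \<delta>) at_top at_top" using \<delta> by real_asymp
    ultimately have "\<forall>\<^sub>F x :: real in at_top. (ln x powr \<delta>) powr (3 / \<delta>) * exp (- d * ln x powr \<delta>) \<le> 1"
      by (rule eventually_compose_filterlim)
    then show ?thesis using eventually_gt_at_top[of "1 :: real"]
    proof eventually_elim
      case (elim x)
      then show ?case using \<delta> by (simp add: powr_powr powr_numeral)
    qed
  qed
  ultimately have "\<forall>\<^sub>F x in at_top. \<forall>T. 2 \<le> T \<and> T \<le> exp (ln x powr (1 - \<delta>)) \<longrightarrow>
       real (Psi k x T) \<le> C * (x * ln (ln x) ^ (k - 2) * ln T / ln x)"
  proof (eventually_elim, intro allI impI)
    fix x T :: real
    assume x: "x \<ge> 2" "ln (ln x) \<ge> 1 + c" "ln x \<ge> 1" "x powr (3 / 4) \<le> x / ln x"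
      "ln x ^ 3 * exp (- d * ln x powr \<delta>) \<le> 1"
      and T: "2 \<le> T \<and> T \<le> exp (ln x powr (1 - \<delta>))"
    define L where "L = ln T"
    define B where "B = x * ln (ln x) ^ m * L / ln x"
    have L2: "L \<ge> ln 2" using T by (simp add: L_def)
    then have L0: "L > 0" using ln_gt_zero[of "2 :: real"] by linarith
    have "ln T \<le> ln (exp (ln x powr (1 - \<delta>)))" using T by (subst ln_le_cancel_iff) auto
    then have Lx: "L \<le> ln x powr (1 - \<delta>)" by (simp add: L_def)
    also have "\<dots> \<le> ln x powr 1" using x \<delta> by (intro powr_mono) auto
    finally have Llnx: "L \<le> ln x" using x by simp
    have "L * ln x powr \<delta> \<le> ln x powr (1 - \<delta>) * ln x powr \<delta>" using Lx by (intro mult_right_mono) auto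
    also have "\<dots> = ln x" using x by (simp flip: powr_add)
    \<comment> \<open>The upper limit on \<open>T\<close> makes the Rankin exponent at least a
      multiple of \<open>ln x powr \<delta>\<close>, enough to beat every power of
      \<open>ln x\<close>.\<close>
    finally have ratio: "ln x powr \<delta> \<le> ln x / L" using L0 by (simp add: field_simps)
    have c0: "c \<ge> 0" by (simp add: c_def)
    have LLm: "1 \<le> ln (ln x) ^ m" using x c0 by (intro one_le_power) auto
    have eM: "exp (pred_prime_sum T) \<le> exp c * L"
    proof -
      have "exp (pred_prime_sum T) \<le> exp (ln L + c)" using c[of T] T by (simp add: L_def)
      then show ?thesis using L0 by (simp add: exp_add mult.commute)
    qed
    have B: "x * L / ln x \<le> B"
    proof -
      have "x * L / ln x * 1 \<le> x * L / ln x * ln (ln x) ^ m"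
        using LLm x L0 by (intro mult_left_mono) auto
      then show ?thesis by (simp add: B_def mult_ac)
    qed
    have "x powr (3 / 4) \<le> 1 / ln 2 * B"
    proof -
      \<comment> \<open>As \<open>T \<ge> 2\<close>, the factor \<open>L / ln 2\<close> is at least
        1, which supplies the \<open>ln T\<close> of the target.\<close>
      have "x / ln x * 1 \<le> x / ln x * (L / ln 2)" using L2 x by (intro mult_left_mono) auto
      then have "x / ln x \<le> 1 / ln 2 * (x * L / ln x)" by (simp add: mult_ac)
      also have "\<dots> \<le> 1 / ln 2 * B" using B by (intro mult_left_mono) auto
      finally show ?thesis using x(4) by linarith
    qed
    moreover have "x * exp (3 * pred_prime_sum T) * exp (- (ln (3 / 2) / 2) * (ln x / L)) \<le> exp (3 * c) * B"
    proof -
      have "exp (3 * pred_prime_sum T) = exp (pred_prime_sum T) ^ 3" by (simp flip: exp_of_nat_mult)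
      also have "\<dots> \<le> (exp c * L) ^ 3" using eM by (intro power_mono) auto
      also have "\<dots> = exp (3 * c) * (L * L\<^sup>2)"
        by (simp add: power_mult_distrib power3_eq_cube power2_eq_square flip: exp_add)
      \<comment> \<open>One factor \<open>L\<close> is kept for the target; the other two are
        bounded by \<open>ln x\<close>.\<close>
      also have "\<dots> \<le> exp (3 * c) * (L * (ln x)\<^sup>2)"
        using L0 Llnx by (intro mult_left_mono power_mono) auto
      finally have 1: "exp (3 * pred_prime_sum T) \<le> exp (3 * c) * (L * (ln x)\<^sup>2)" .
      have "d * ln x powr \<delta> \<le> d * (ln x / L)" using ratio d by (intro mult_left_mono) auto
      then have "exp (- d * (ln x / L)) \<le> exp (- d * ln x powr \<delta>)" by simp
      also have "\<dots> \<le> 1 / ln x ^ 3" using x by (simp add: field_simps)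
      finally have "x * exp (3 * pred_prime_sum T) * exp (- d * (ln x / L))
          \<le> x * (exp (3 * c) * (L * (ln x)\<^sup>2)) * (1 / ln x ^ 3)"
        using x 1 L0 by (intro mult_mono) auto
      also have "\<dots> = exp (3 * c) * (x * L / ln x)"
        using x by (simp add: power3_eq_cube power2_eq_square field_simps)
      also have "\<dots> \<le> exp (3 * c) * B" using B by (intro mult_left_mono) auto
      finally show ?thesis by (simp add: d_def)
    qed
    moreover have "64 * x / ln x * ((1 + pred_prime_sum x) ^ m * exp (pred_prime_sum T)) \<le> 64 * 2 ^ m * exp c * B"
    proof -
      have "(1 + pred_prime_sum x) ^ m \<le> (2 * ln (ln x)) ^ m"
        using c[of x] x pred_prime_sum_nonneg[of x] by (intro power_mono) auto
      with eM have "64 * x / ln x * ((1 + pred_prime_sum x) ^ m * exp (pred_prime_sum T))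
          \<le> 64 * x / ln x * ((2 * ln (ln x)) ^ m * (exp c * L))"
        using x L0 c0 by (intro mult_left_mono mult_mono) auto
      also have "\<dots> = 64 * 2 ^ m * exp c * B" by (simp add: B_def power_mult_distrib mult_ac)
      finally show ?thesis .
    qed
    moreover have "real (Psi k x T) \<le> real (card (few_rough_primes T (Suc m) x))"
      using Psi_le_card_few_rough_primes[of k x T] k by (simp add: m_def Suc_diff_Suc numeral_2_eq_2)
    moreover have "\<dots> \<le> x powr (3 / 4)
        + x * exp (3 * pred_prime_sum T) * exp (- (ln (3 / 2) / 2) * (ln x / L))
        + 64 * x / ln x * ((1 + pred_prime_sum x) ^ m * exp (pred_prime_sum T))"
      using card_few_rough_primes_le[of T x m] T x by (simp add: L_def)
    ultimately have "real (Psi k x T) \<le> 1 / ln 2 * B + exp (3 * c) * B + 64 * 2 ^ m * exp c * B"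
      by linarith
    also have "\<dots> = C * B" by (simp only: C_def distrib_right)
    finally show "real (Psi k x T) \<le> C * (x * ln (ln x) ^ (k - 2) * ln T / ln x)"
      by (simp only: B_def L_def m_def)
  qed
  moreover have "C > 0" by (simp add: C_def add_pos_pos)
  ultimately show ?thesis by blast
qed

text \<open>For fixed \<open>T\<close> the choice \<open>\<delta> = 1 / 2\<close> suffices, since
  the permitted range eventually contains \<open>T\<close>, and
  \<open>ln (ln x) ^ (k - 2) / ln x\<close> tends to 0. Raising \<open>T\<close> to
  \<open>U = max T 2\<close> only enlarges the set and meets the lower limit 2.\<close>

lemma has_natural_density_P_le:
  assumes k: "k \<ge> 2"
  shows "has_natural_density {n. 1 \<le> n \<and> real (P k n) \<le> T} 0"
proof -
  define A where "A = {n. 1 \<le> n \<and> real (P k n) \<le> T}"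
  define U where "U = max T 2"
  obtain C where C: "C > 0"
    "\<forall>\<^sub>F x in at_top. \<forall>T. 2 \<le> T \<and> T \<le> exp (ln x powr (1 - 1 / 2)) \<longrightarrow>
       real (Psi k x T) \<le> C * (x * ln (ln x) ^ (k - 2) * ln T / ln x)"
    using Psi_le[OF k, of "1 / 2"] by auto
  have "\<forall>\<^sub>F x :: real in at_top. U \<le> exp (ln x powr (1 - 1 / 2))" by real_asymp
  with C(2) have "\<forall>\<^sub>F x in at_top. real (Psi k x U) \<le> C * (x * ln (ln x) ^ (k - 2) * ln U / ln x)"
    by eventually_elim (simp add: U_def)
  then have ev: "\<forall>\<^sub>F N in sequentially. real (Psi k (real N) U)
      \<le> C * (real N * ln (ln (real N)) ^ (k - 2) * ln U / ln (real N))"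
    by (rule eventually_compose_filterlim[OF _ filterlim_real_sequentially])
  have "(\<lambda>N. real (card (A \<inter> {1..N})) / real N) \<longlonglongrightarrow> 0"
  proof (rule tendsto_sandwich[OF _ _ tendsto_const])
    show "\<forall>\<^sub>F N in sequentially. real (card (A \<inter> {1..N})) / real N
        \<le> C * ln U * (ln (ln (real N)) ^ (k - 2) / ln (real N))"
      using ev eventually_gt_at_top[of 0]
    proof eventually_elim
      case (elim N)
      have "card (A \<inter> {1..N}) \<le> Psi k (real N) U"
        unfolding Psi_def
        by (intro card_mono finite_subset[OF _ finite_nat_le[of "real N"]]) (auto simp: A_def U_def)
      then have "real (card (A \<inter> {1..N})) / real N \<le> real (Psi k (real N) U) / real N"
        by (intro divide_right_mono) auto
      also have "\<dots> \<le> (C * (real N * ln (ln (real N)) ^ (k - 2) * ln U / ln (real N))) / real N"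
        using elim by (intro divide_right_mono) auto
      also have "\<dots> = C * ln U * (ln (ln (real N)) ^ (k - 2) / ln (real N))"
        using elim by simp
      finally show ?case .
    qed
    have "(\<lambda>N. ln (ln (real N)) ^ (k - 2) / ln (real N)) \<longlonglongrightarrow> 0"
      by real_asymp
    then show "(\<lambda>N. C * ln U * (ln (ln (real N)) ^ (k - 2) / ln (real N))) \<longlonglongrightarrow> 0"
      by (rule tendsto_mult_right_zero)
  qed auto
  then show ?thesis by (simp add: has_natural_density_def A_def)
qed

theorem theorem5p2:
  fixes k :: nat
  assumes "k \<ge> 2"
  shows "(\<forall>\<delta>::real. \<delta> > 0 \<longrightarrow>
           (\<exists>C::real. C > 0 \<and>
             (\<forall>\<^sub>F x::real in at_top. \<forall>T::real.
                2 \<le> T \<and> T \<le> exp ((ln x) powr (1 - \<delta>)) \<longrightarrow>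
                real (Psi k x T) \<le> C * (x * (ln (ln x)) ^ (k - 2) * ln T / ln x))))
       \<and> (\<forall>T::real. has_natural_density {n :: nat. 1 \<le> n \<and> real (P k n) \<le> T} 0)"
  using Psi_le[OF assms] has_natural_density_P_le[OF assms] by blast

end
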